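(* The quotient space $C_P=[-1,1]^2/\!\sim_{CP}$ (with the quotient topology) is homeomorphic to the subspace $P$ of $\mathbb{R}^4$.
   Context: On the square $[-1,1]^2$ (fundamental polygon of the real projective plane) the equivalence relation $\sim_{CP}$ is defined by: $(x,y)\sim_{CP}(x',y')$ if and only if either ($x\in\{-1,1\}$ or $y\in\{-1,1\}$) and $(x',y')=\pm(x,y)$, or (neither $x$ nor $y$ is in $\{-1,1\}$) and $(x',y')=(x,y)$. Let $\mathcal{S}^2=\{(x,y,z)\in\mathbb{R}^3: x^2+y^2+z^2=1\}$. The map $p:\mathcal{S}^2\to\mathbb{R}^4$ is defined by $p(x,y,z)=(xy,\ xz,\ y^2-z^2,\ 2yz)$, and $P=p(\mathcal{S}^2)\subset\mathbb{R}^4$ is its image, with the subspace topology. *)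

theory Defs
  imports "HOL-Analysis.Analysis"
begin

definition quotient_topology :: "'a topology \<Rightarrow> ('a \<times> 'a) set \<Rightarrow> 'a set topology" where
  "quotient_topology X r =
     topology (\<lambda>U. U \<subseteq> topspace X // r \<and> openin X {x \<in> topspace X. r `` {x} \<in> U})"

lemma openin_quotient_topology:
  "openin (quotient_topology X r) U \<longleftrightarrow>
     U \<subseteq> topspace X // r \<and> openin X {x \<in> topspace X. r `` {x} \<in> U}"
proof -
  let ?L = "\<lambda>U. U \<subseteq> topspace X // r \<and> openin X {x \<in> topspace X. r `` {x} \<in> U}"
  have "istopology ?L"
    unfolding istopology_def
  proof (intro conjI allI impI)
    fix S T assume S: "?L S" and T: "?L T"
    then show "S \<inter> T \<subseteq> topspace X // r" by blast
    have "{x \<in> topspace X. r `` {x} \<in> S \<inter> T} =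
          {x \<in> topspace X. r `` {x} \<in> S} \<inter> {x \<in> topspace X. r `` {x} \<in> T}" by blast
    then show "openin X {x \<in> topspace X. r `` {x} \<in> S \<inter> T}"
      using S T by (simp add: openin_Int)
  next
    fix K assume K: "\<forall>S\<in>K. ?L S"
    then show "\<Union>K \<subseteq> topspace X // r" by blast
    have "{x \<in> topspace X. r `` {x} \<in> \<Union>K} =
          (\<Union>S\<in>K. {x \<in> topspace X. r `` {x} \<in> S})" by blast
    then show "openin X {x \<in> topspace X. r `` {x} \<in> \<Union>K}"
      using K by (auto intro!: openin_Union)
  qed
  then show ?thesis
    by (simp add: quotient_topology_def topology_inverse')
qed

lemma topspace_quotient_topology: "topspace (quotient_topology X r) = topspace X // r"
proof -
  have "{x \<in> topspace X. r `` {x} \<in> topspace X // r} = topspace X"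
    by (auto simp: quotient_def)
  then have "openin (quotient_topology X r) (topspace X // r)"
    by (simp add: openin_quotient_topology)
  then show ?thesis
    by (metis openin_quotient_topology openin_subset openin_topspace subset_antisym)
qed

lemma quotient_map_quotient_topology:
  "quotient_map X (quotient_topology X r) (\<lambda>x. r `` {x})"
  unfolding quotient_map_def topspace_quotient_topology openin_quotient_topology
  by (auto simp: quotient_def)

definition square :: "(real \<times> real) set" where
  "square = {-1..1} \<times> {-1..1}"

definition sim_CP :: "((real \<times> real) \<times> (real \<times> real)) set" where
  "sim_CP = {((x, y), (x', y')). (x, y) \<in> square \<and> (x', y') \<in> square \<and>
     ((x \<in> {-1, 1} \<or> y \<in> {-1, 1}) \<and> ((x', y') = (x, y) \<or> (x', y') = - (x, y)) \<or>
      (x \<notin> {-1, 1} \<and> y \<notin> {-1, 1}) \<and> (x', y') = (x, y))}"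

lemma equiv_sim_CP: "equiv square sim_CP"
  unfolding equiv_def refl_on_def sym_def trans_def sim_CP_def
  by auto

definition C_P :: "(real \<times> real) set topology" where
  "C_P = quotient_topology (top_of_set square) sim_CP"

definition S2 :: "(real ^ 3) set" where
  "S2 = {v. (v $ 1)\<^sup>2 + (v $ 2)\<^sup>2 + (v $ 3)\<^sup>2 = 1}"

definition p :: "real ^ 3 \<Rightarrow> real ^ 4" where
  "p v = (let x = v $ 1; y = v $ 2; z = v $ 3
          in vector [x * y, x * z, y\<^sup>2 - z\<^sup>2, 2 * y * z])"

lemma p_component:
  "p v $ 1 = v $ 1 * v $ 2"
  "p v $ 2 = v $ 1 * v $ 3"
  "p v $ 3 = (v $ 2)\<^sup>2 - (v $ 3)\<^sup>2"
  "p v $ 4 = 2 * v $ 2 * v $ 3"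
  unfolding p_def Let_def vector_def by simp_all

definition P :: "(real ^ 4) set" where
  "P = p ` S2"

end

theory Submission
  imports Defs
begin

text \<open>
  The map \<^term>\<open>p\<close> is even, and its value at a point of the sphere determines that point up to sign,
  so \<^term>\<open>P\<close> is the sphere with antipodal points identified. Every antipodal pair meets the closed
  hemisphere where the first coordinate is nonnegative, and meets it in a single point unless the
  pair lies on the equator. It therefore suffices to map the square bijectively onto this hemisphere
  so that the boundary goes onto the equator by an odd map (\<open>hemi\<close> below): following it by
  \<^term>\<open>p\<close> identifies exactly the points that \<^term>\<open>sim_CP\<close> identifies
  (\<open>p_hemi_eq_iff\<close>) and reaches all of \<^term>\<open>P\<close> (\<open>p_hemi_image\<close>).

  Such a map comes from lifting the square to the pyramid over it, a point at height
  one minus its maximum norm, and then projecting radially to the sphere. The pyramid is the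
  part at nonnegative height of the unit sphere of a norm on three-space, which makes the
  projection bijective, and it has height zero exactly over the boundary of the square.

  The topology is the standard compactness argument: a continuous surjection from a
  compact space to a Hausdorff space induces a homeomorphism from the quotient by its fibres
  (\<open>quotient_homeomorphic_image\<close>).
\<close>

section \<open>Quotients of compact spaces\<close>

lemma quotient_homeomorphic_image:
  assumes X: "compact_space X" and Y: "Hausdorff_space Y"
    and f: "continuous_map X Y f" and surj: "f ` topspace X = topspace Y"
    and r: "equiv (topspace X) r"
    and fibres: "\<And>x y. x \<in> topspace X \<Longrightarrow> y \<in> topspace X \<Longrightarrow> f x = f y \<longleftrightarrow> (x, y) \<in> r"
  shows "quotient_topology X r homeomorphic_space Y"
proof -
  let ?Q = "quotient_topology X r" and ?q = "\<lambda>x. r `` {x}"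
  have q: "quotient_map X ?Q ?q"
    by (rule quotient_map_quotient_topology)
  have q_eq: "?q x = ?q y \<longleftrightarrow> f x = f y" if "x \<in> topspace X" "y \<in> topspace X" for x y
    using fibres[OF that] eq_equiv_class_iff[OF r that] by simp
  obtain g where g: "continuous_map ?Q Y g" "g ` topspace ?Q = f ` topspace X"
      "\<And>x. x \<in> topspace X \<Longrightarrow> g (?q x) = f x"
    using quotient_map_lift_exists[OF q f] q_eq by metis
  have topQ: "topspace ?Q = ?q ` topspace X"
    using quotient_imp_surjective_map[OF q] by simp
  have "compactin ?Q (topspace ?Q)"
    unfolding topQ using X quotient_imp_continuous_map[OF q]
    by (meson compact_space_def image_compactin)
  then have "compact_space ?Q"
    by (simp add: compact_space_def)
  moreover have "inj_on g (topspace ?Q)"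
    unfolding topQ inj_on_def using g(3) q_eq by auto
  ultimately have "homeomorphic_map ?Q Y g"
    using g Y surj by (intro continuous_imp_homeomorphic_map) auto
  then show ?thesis
    by (rule homeomorphic_map_imp_homeomorphic_space)
qed

section \<open>The fibres of the map to four-space\<close>

lemma continuous_on_p: "continuous_on A p"
proof -
  have "\<forall>i. continuous_on A (\<lambda>v. p v $ i)"
    unfolding forall_4 p_component by (auto intro!: continuous_intros)
  then have "continuous_on A (\<lambda>v. \<chi> i. p v $ i)"
    by (intro continuous_on_vec_lambda) auto
  then show ?thesis by simp
qed

lemma p_minus: "p (- v) = p v"
  by (simp add: vec_eq_iff forall_4 p_component)

text \<open>The last two coordinates of \<^term>\<open>p\<close> are the real and imaginary part of the square of
  \<open>y + \<i> z\<close>, so they determine \<open>(y, z)\<close> up to sign. If \<open>(y, z)\<close> is not zero, the first two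
  coordinates then determine \<open>x\<close>; otherwise the point is a pole and \<open>x\<close> is \<open>1\<close> or \<open>-1\<close>.\<close>

lemma p_eq_iff:
  assumes "v \<in> S2" "w \<in> S2"
  shows "p v = p w \<longleftrightarrow> v = w \<or> v = - w"
proof
  assume eq: "p v = p w"
  define x y z where d: "x = v $ 1" "y = v $ 2" "z = v $ 3"
  define x' y' z' where d': "x' = w $ 1" "y' = w $ 2" "z' = w $ 3"
  have e: "x * y = x' * y'" "x * z = x' * z'" "y\<^sup>2 - z\<^sup>2 = y'\<^sup>2 - z'\<^sup>2" "2 * y * z = 2 * y' * z'"
    using eq by (simp_all add: vec_eq_iff forall_4 p_component d d')
  have s: "x\<^sup>2 + y\<^sup>2 + z\<^sup>2 = 1" "x'\<^sup>2 + y'\<^sup>2 + z'\<^sup>2 = 1"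
    using assms by (simp_all add: S2_def d d')
  have "(Complex y z)\<^sup>2 = (Complex y' z')\<^sup>2"
    using e(3,4) by (simp add: complex_eq_iff power2_eq_square mult.commute)
  then have "Complex y z = Complex y' z' \<or> Complex y z = - Complex y' z'"
    by (simp add: power2_eq_iff)
  then have yz: "y = y' \<and> z = z' \<or> y = - y' \<and> z = - z'"
    by (auto simp: complex_eq_iff)
  have "x = x' \<and> y = y' \<and> z = z' \<or> x = - x' \<and> y = - y' \<and> z = - z'"
  proof (cases "y' = 0 \<and> z' = 0")
    case True
    then have "x\<^sup>2 = x'\<^sup>2" using yz s by auto
    then show ?thesis using True yz by (auto simp: power2_eq_iff)
  next
    case False
    from yz show ?thesis
    proof
      assume "y = y' \<and> z = z'"
      then show ?thesis using e(1,2) False by auto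
    next
      assume h: "y = - y' \<and> z = - z'"
      then have "(x + x') * y' = 0" "(x + x') * z' = 0"
        using e(1,2) by (auto simp: algebra_simps)
      then have "x + x' = 0" using False by auto
      then show ?thesis using h by auto
    qed
  qed
  then show "v = w \<or> v = - w"
    by (simp add: vec_eq_iff forall_3 d d')
qed (auto simp: p_minus)

section \<open>The square as a hemisphere\<close>

definition pyramid :: "real \<times> real \<Rightarrow> real ^ 3" where
  "pyramid u = vector [1 - max \<bar>fst u\<bar> \<bar>snd u\<bar>, fst u, snd u]"

definition hemi :: "real \<times> real \<Rightarrow> real ^ 3" where
  "hemi u = pyramid u /\<^sub>R norm (pyramid u)"

lemma pyramid_component:
  "pyramid u $ 1 = 1 - max \<bar>fst u\<bar> \<bar>snd u\<bar>"
  "pyramid u $ 2 = fst u"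
  "pyramid u $ 3 = snd u"
  by (simp_all add: pyramid_def)

lemma pyramid_nonzero: "pyramid u \<noteq> 0"
  by (auto simp: vec_eq_iff forall_3 pyramid_component)

lemma S2_iff_norm: "v \<in> S2 \<longleftrightarrow> norm v = 1"
  by (simp add: S2_def norm_vec_def L2_set_def sum_3)

lemma hemi_in_S2: "hemi u \<in> S2"
  by (simp add: S2_iff_norm hemi_def pyramid_nonzero)

lemma continuous_on_hemi: "continuous_on A hemi"
proof -
  have "\<forall>i. continuous_on A (\<lambda>u. pyramid u $ i)"
    unfolding forall_3 pyramid_component by (auto intro!: continuous_intros)
  then have "continuous_on A (\<lambda>u. \<chi> i. pyramid u $ i)"
    by (intro continuous_on_vec_lambda) auto
  then have "continuous_on A pyramid" by simp
  then show ?thesis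
    unfolding hemi_def by (intro continuous_intros) (auto simp: pyramid_nonzero)
qed

text \<open>A line through the origin meets the pyramid in one point, or in two opposite points of the
  rim at height zero: with \<open>M\<close> the maximum norm, proportional points satisfy \<open>1 - M u = c (1 - M v)\<close> and
  \<open>M u = \<bar>c\<bar> M v\<close>. For positive \<open>c\<close> these add up to \<open>c = 1\<close>; for negative \<open>c\<close> the first forces
  both heights to vanish, and then the second gives \<open>c = - 1\<close>.\<close>

lemma pyramid_proportional:
  assumes u: "u \<in> square" and v: "v \<in> square"
    and eq: "pyramid u = c *\<^sub>R pyramid v" and c: "c \<noteq> 0"
  shows "u = v \<or> max \<bar>fst u\<bar> \<bar>snd u\<bar> = 1 \<and> u = - v"
proof -
  let ?M = "\<lambda>u :: real \<times> real. max \<bar>fst u\<bar> \<bar>snd u\<bar>"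
  have comp: "1 - ?M u = c * (1 - ?M v)" "fst u = c * fst v" "snd u = c * snd v"
    using arg_cong[OF eq, of "\<lambda>w. w $ 1"] arg_cong[OF eq, of "\<lambda>w. w $ 2"]
      arg_cong[OF eq, of "\<lambda>w. w $ 3"] by (simp_all add: pyramid_component)
  have M: "?M u = \<bar>c\<bar> * ?M v"
    unfolding comp(2,3) abs_mult by (simp add: max_mult_distrib_left)
  have le: "?M u \<le> 1" "?M v \<le> 1"
    using u v by (auto simp: square_def)
  show ?thesis
  proof (cases "c > 0")
    case True
    then have "c = 1" using M comp(1) by (simp add: algebra_simps)
    then show ?thesis using comp by (simp add: prod_eq_iff)
  next
    case False
    then have neg: "c < 0" using c by simp
    then have "c * (1 - ?M v) \<le> 0" using le by (simp add: mult_nonpos_nonneg)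
    then have 1: "?M u = 1" using le comp(1) by linarith
    then have "?M v = 1" using comp(1) c by simp
    then have "c = - 1" using 1 M neg by simp
    then show ?thesis using comp 1 by (simp add: prod_eq_iff)
  qed
qed

lemma hemi_eq_uminus:
  assumes "max \<bar>fst u\<bar> \<bar>snd u\<bar> = 1"
  shows "hemi (- u) = - hemi u"
proof -
  have "pyramid (- u) = - pyramid u"
    using assms by (simp add: vec_eq_iff forall_3 pyramid_component)
  then show ?thesis by (simp add: hemi_def)
qed

lemma sim_CP_iff:
  assumes "u \<in> square" "v \<in> square"
  shows "(u, v) \<in> sim_CP \<longleftrightarrow> u = v \<or> max \<bar>fst u\<bar> \<bar>snd u\<bar> = 1 \<and> u = - v"
proof -
  obtain a b where ab: "u = (a, b)" by fastforce
  obtain a' b' where ab': "v = (a', b')" by fastforce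
  have "max \<bar>a\<bar> \<bar>b\<bar> = 1 \<longleftrightarrow> a \<in> {-1, 1} \<or> b \<in> {-1, 1}"
    using assms(1) by (auto simp: ab square_def)
  then show ?thesis
    using assms by (auto simp: ab ab' sim_CP_def)
qed

lemma p_hemi_eq_iff:
  assumes u: "u \<in> square" and v: "v \<in> square"
  shows "p (hemi u) = p (hemi v) \<longleftrightarrow> (u, v) \<in> sim_CP"
proof
  let ?n = "norm (pyramid u)" and ?m = "norm (pyramid v)"
  assume "p (hemi u) = p (hemi v)"
  then consider "hemi u = hemi v" | "hemi u = - hemi v"
    using p_eq_iff hemi_in_S2 by blast
  then obtain s :: real where s: "s \<noteq> 0" "hemi u = s *\<^sub>R hemi v"
  proof cases
    case 1
    then show ?thesis using that[of 1] by simp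
  next
    case 2
    then show ?thesis using that[of "- 1"] by simp
  qed
  have "pyramid u = ?n *\<^sub>R hemi u"
    by (simp add: hemi_def pyramid_nonzero)
  also have "\<dots> = (?n * s / ?m) *\<^sub>R pyramid v"
    by (simp add: s(2)) (simp add: hemi_def divide_inverse)
  finally show "(u, v) \<in> sim_CP"
    using pyramid_proportional[OF u v] s(1) by (simp add: sim_CP_iff[OF u v] pyramid_nonzero)
next
  assume "(u, v) \<in> sim_CP"
  then consider "u = v" | "max \<bar>fst v\<bar> \<bar>snd v\<bar> = 1" "u = - v"
    by (auto simp: sim_CP_iff[OF u v])
  then show "p (hemi u) = p (hemi v)"
    by cases (simp_all add: hemi_eq_uminus p_minus)
qed

lemma hemi_surj:
  assumes v: "v \<in> S2" and pos: "v $ 1 \<ge> 0"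
  shows "v \<in> hemi ` square"
proof -
  let ?m = "max \<bar>v $ 2\<bar> \<bar>v $ 3\<bar>"
  \<comment> \<open>The norm whose unit sphere contains the pyramid, evaluated at \<^term>\<open>v\<close>; dividing by it moves
    \<^term>\<open>v\<close> radially onto the pyramid.\<close>
  define t where "t = v $ 1 + ?m"
  have "t \<noteq> 0"
  proof
    assume "t = 0"
    then have "v $ 1 = 0" "v $ 2 = 0" "v $ 3 = 0"
      using pos unfolding t_def by linarith+
    then show False using v by (simp add: S2_def)
  qed
  then have t: "t > 0" using pos unfolding t_def by linarith
  define u where "u = (v $ 2 / t, v $ 3 / t)"
  have M: "max \<bar>fst u\<bar> \<bar>snd u\<bar> = ?m / t"
    using t by (simp add: u_def max_divide_distrib_right)
  have "1 - ?m / t = v $ 1 / t"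
    using t by (simp add: t_def field_simps)
  then have pyr: "pyramid u = v /\<^sub>R t"
    using M by (simp add: vec_eq_iff forall_3 pyramid_component u_def divide_inverse mult.commute)
  then have "hemi u = v"
    using t v by (simp add: hemi_def S2_iff_norm)
  moreover have "max \<bar>fst u\<bar> \<bar>snd u\<bar> \<le> 1"
    using t pos by (simp add: M t_def)
  then have "u \<in> square"
    by (cases u) (auto simp: square_def abs_le_iff)
  ultimately show ?thesis by blast
qed

lemma p_hemi_image: "(p \<circ> hemi) ` square = P"
proof
  show "(p \<circ> hemi) ` square \<subseteq> P"
    using hemi_in_S2 by (auto simp: P_def)
  show "P \<subseteq> (p \<circ> hemi) ` square"
  proof
    fix a assume "a \<in> P"
    then obtain v where v: "v \<in> S2" "a = p v" by (auto simp: P_def)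
    have "- v \<in> S2" using v(1) by (simp add: S2_iff_norm)
    moreover have "v $ 1 \<ge> 0 \<or> (- v) $ 1 \<ge> 0" by auto
    ultimately have "v \<in> hemi ` square \<or> - v \<in> hemi ` square"
      using hemi_surj v(1) by blast
    then show "a \<in> (p \<circ> hemi) ` square"
      using v(2) p_minus[of v] by (metis imageI image_comp)
  qed
qed

section \<open>The projective plane\<close>

theorem mainTheorem4:
  shows "C_P homeomorphic_space top_of_set P"
  unfolding C_P_def
proof (rule quotient_homeomorphic_image)
  show "compact_space (top_of_set square)"
    by (simp add: compact_space_subtopology square_def compact_Times)
  show "Hausdorff_space (top_of_set P)"
    by (simp add: Hausdorff_space_subtopology)
  have "continuous_on square (p \<circ> hemi)"
    by (intro continuous_on_compose continuous_on_hemi continuous_on_p)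
  then show "continuous_map (top_of_set square) (top_of_set P) (p \<circ> hemi)"
    using p_hemi_image by auto
  show "(p \<circ> hemi) ` topspace (top_of_set square) = topspace (top_of_set P)"
    using p_hemi_image by simp
  show "equiv (topspace (top_of_set square)) sim_CP"
    by (simp add: equiv_sim_CP)
qed (simp add: p_hemi_eq_iff)

end
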